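(* Let $d\ge1$, $0\le k\le d$ and $n=d+1-k\ge1$. Upon specializing $tr(1)=d$ one has $$\mathtt t\big(\mathfrak C_{k,d}(x)\big)=0,\qquad \mathtt t\big(\mathfrak C_{k,d}(x)\cdot 1^{\otimes n-1}\otimes x\big)=-(k+1)\cdot\mathfrak C_{k+1,d}(x).$$
   Context: Work over $\mathbb Q$; $X$ is a set of variables, $x\in X$, and $\epsilon_\sigma=\pm1$ is the sign of $\sigma$. $T\langle X\rangle=\mathbb Q\langle X\rangle[tr(M)]$ is the free algebra with trace: the polynomial algebra over the free associative unital algebra $\mathbb Q\langle X\rangle$ in commuting central indeterminates $tr(M)$, one for each cyclic equivalence class of monomials $M$ (including $M=1$), with the obvious $\mathbb Q[tr(M)]$-linear trace. $T\langle X\rangle^{\otimes n}$ is the $n$-fold tensor product over $\mathbb Q[tr(M)]$, and $\mathcal T(X,n)=T\langle X\rangle^{\otimes n}\ltimes\mathbb Q[S_n]$ is $T\langle X\rangle^{\otimes n}\otimes\mathbb Q[S_n]$ with commutation relations $\sigma\circ M_1\otimes\cdots\otimes M_n=M_{\sigma^{-1}(1)}\otimes\cdots\otimes M_{\sigma^{-1}(n)}\circ\sigma$; for $n=0$ it is $\mathbb Q[tr(M)]$. "Specializing $tr(1)=d$" means working modulo the ideal generated by $tr(1)-d$. Formal partial trace: for $n\ge1$, $\mathtt t:\mathcal T(X,n)\to\mathcal T(X,n-1)$ is the $\mathbb Q[tr(M)]$-linear map which for $n=1$ is $tr:T\langle X\rangle\to\mathbb Q[tr(M)]$, and for $n\ge2$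 is given, for $\tau\in S_{n-1}$ (permutations in $S_n$ fixing $n$), $1\le i\le n-1$ and monomials $M_j$, by $\mathtt t(\tau\circ M_1\otimes\cdots\otimes M_n)=tr(M_n)\,\tau\circ M_1\otimes\cdots\otimes M_{n-1}$ and $\mathtt t(\tau(n,i)\circ M_1\otimes\cdots\otimes M_n)=\tau\circ M_1\otimes\cdots\otimes M_nM_i\otimes\cdots\otimes M_{n-1}$ (with $M_nM_i$ in position $i$). The elements $\mathfrak C_{k,d}(x)\in\mathcal T(X,d+1-k)$: let $\sigma_r(x)=\frac1{r!}\sum_{\sigma\in S_r}\epsilon_\sigma t_\sigma(x)$, where $t_\sigma(x)=\prod_jtr(x^{\ell_j})$ with $\ell_j$ the lengths of the cycles of $\sigma$. For $n\ge1$, $i\ge0$ let $\mathfrak T_{i,n}(x)=\sum x^{h_1}\otimes\cdots\otimes x^{h_n}$, sum over all $(h_1,\dots,h_n)\in\mathbb Z_{\ge0}^n$ with $\sum h_j=i$. For $0\le k\le d$, $n=d+1-k$, $$\mathfrak C_{k,d}(x):=\Big(\sum_{\tau\in S_n}\epsilon_\tau\tau\Big)\circ\Big[\mathfrak T_{k,n}(x)+\sum_{j=1}^k(-1)^j\sigma_j(x)\mathfrak T_{k-j,n}(x)\Big],$$ and $\mathfrak C_{d+1,d}(x):=\frac{(-1)^{d+1}}{(d+1)!}\sum_{\sigma\in S_{d+1}}\epsilon_\sigma t_\sigma(x)=(-1)^{d+1}\sigma_{d+1}(x)$. *)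

theory Defs
  imports
    Complex_Main
    "HOL-Library.Poly_Mapping"
    "HOL-Combinatorics.Perm"
    "HOL-Combinatorics.Permutations"
begin

unbundle permutation_syntax

text \<open>
  The set of variables \<open>X\<close> is the type \<open>'x\<close>.  Monomials are words in \<open>'x\<close>; their multiplication
  (concatenation) is written additively, because \<open>'a \<Rightarrow>\<^sub>0 'b\<close> is a monoid algebra over an
  additively written, not necessarily commutative, monoid \<open>'a\<close>.  So \<open>0 :: 'x mon\<close> is the
  monomial \<open>1\<close> and \<open>M + N\<close> is the product \<open>M N\<close>.
\<close>

datatype 'x mon = Mon (letters: "'x list")

instantiation mon :: (type) monoid_add
begin
definition zero_mon :: "'a mon" where "zero_mon = Mon []"
definition plus_mon :: "'a mon \<Rightarrow> 'a mon \<Rightarrow> 'a mon" where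
  "M + N = Mon (letters M @ letters N)"
instance by standard (auto simp: zero_mon_def plus_mon_def)
end

definition var_pow :: "'x \<Rightarrow> nat \<Rightarrow> 'x mon" where
  "var_pow x h = Mon (replicate h x)"

definition cyc_equiv :: "'x mon \<Rightarrow> 'x mon \<Rightarrow> bool" where
  "cyc_equiv M N \<longleftrightarrow> (\<exists>k. letters N = rotate k (letters M))"

lemma equivp_cyc_equiv: "equivp cyc_equiv"
proof (rule equivpI)
  show "reflp cyc_equiv"
    by (rule reflpI) (auto simp: cyc_equiv_def intro: exI[of _ 0])
  show "symp cyc_equiv"
  proof (rule sympI)
    fix M N :: "'x mon"
    assume "cyc_equiv M N"
    then obtain k where k: "letters N = rotate k (letters M)"
      by (auto simp: cyc_equiv_def)
    let ?l = "length (letters M)"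
    have "rotate (?l - k mod ?l) (letters N) = letters M"
    proof (cases "letters M = []")
      case True
      then show ?thesis using k by simp
    next
      case False
      then have "k mod ?l < ?l" by simp
      have "rotate (?l - k mod ?l) (letters N)
          = rotate (?l - k mod ?l) (rotate (k mod ?l) (letters M))"
        using k rotate_conv_mod[of k "letters M"] by simp
      also have "\<dots> = rotate ?l (letters M)"
        using \<open>k mod ?l < ?l\<close> by (simp add: rotate_rotate)
      finally show ?thesis by simp
    qed
    then show "cyc_equiv N M" by (metis cyc_equiv_def)
  qed
  show "transp cyc_equiv"
    by (rule transpI) (auto simp: cyc_equiv_def rotate_rotate)
qed

quotient_type 'x cyc = "'x mon" / cyc_equiv
  by (rule equivp_cyc_equiv)

text \<open>The polynomial ring \<open>\<rat>[tr(M)]\<close>, with one indeterminate for each cyclic class.\<close>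

type_synonym 'x tr_poly = "('x cyc \<Rightarrow>\<^sub>0 nat) \<Rightarrow>\<^sub>0 rat"

definition rat_const :: "rat \<Rightarrow> 'x tr_poly" where
  "rat_const q = Poly_Mapping.single 0 q"

definition tr :: "'x mon \<Rightarrow> 'x tr_poly" where
  "tr M = Poly_Mapping.single (Poly_Mapping.single (abs_cyc M) 1) 1"

text \<open>
  \<open>T\<langle>X\<rangle>\<close> is a free \<open>\<rat>[tr(M)]\<close>-module on the monomials, hence the \<open>n\<close>-fold tensor power over
  \<open>\<rat>[tr(M)]\<close> is free on the \<open>n\<close>-tuples \<open>M\<^sub>1 \<otimes> \<dots> \<otimes> M\<^sub>n\<close> of monomials, and \<open>\<T>(X,n)\<close> is free on the
  elements \<open>\<sigma> \<circ> M\<^sub>1 \<otimes> \<dots> \<otimes> M\<^sub>n\<close> with \<open>\<sigma> \<in> S\<^sub>n\<close>.  To have one ring containing all \<open>\<T>(X,n)\<close>, a tuple is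
  a finitely supported function on \<open>nat\<close> (equal to the monomial \<open>1\<close> outside \<open>{1..n}\<close>) and a
  permutation is a finitely supported one of \<open>nat\<close>; \<open>Tw \<sigma> M\<close> is the basis element \<open>\<sigma> \<circ> M\<close>.
  The product is forced by the commutation relation, which gives
  \<open>M \<circ> \<tau> = \<tau> \<circ> (M\<^bsub>\<tau>(1)\<^esub> \<otimes> \<dots> \<otimes> M\<^bsub>\<tau>(n)\<^esub>)\<close>.
\<close>

datatype 'x tw = Tw "nat perm" "nat \<Rightarrow>\<^sub>0 'x mon"

lemma inj_apply_perm: "inj (apply (\<sigma> :: 'a perm))"
  by (simp add: bij_is_inj)

lemma map_key_apply_one: "Poly_Mapping.map_key (apply 1) M = M"
  by (rule poly_mapping_eqI) (simp add: map_key.rep_eq)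

instantiation tw :: (type) monoid_add
begin

definition zero_tw :: "'a tw" where "zero_tw = Tw 1 0"

fun plus_tw :: "'a tw \<Rightarrow> 'a tw \<Rightarrow> 'a tw" where
  "Tw \<sigma> M + Tw \<tau> N = Tw (\<sigma> * \<tau>) (Poly_Mapping.map_key (apply \<tau>) M + N)"

instance
proof
  fix a b c :: "'a tw"
  show "a + b + c = a + (b + c)"
    by (cases a; cases b; cases c)
      (simp add: mult.assoc map_key_plus map_key_compose inj_apply_perm apply_times add.assoc)
  show "0 + a = a"
    by (cases a) (simp add: zero_tw_def inj_apply_perm)
  show "a + 0 = a"
    by (cases a) (simp add: zero_tw_def map_key_apply_one del: apply_one)
qed

end

type_synonym 'x tw_alg = "'x tw \<Rightarrow>\<^sub>0 'x tr_poly"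

definition Sym :: "nat \<Rightarrow> nat perm set" where
  "Sym n = {\<sigma>. affected \<sigma> \<subseteq> {1..n}}"

definition scal :: "'x tr_poly \<Rightarrow> 'x tw_alg" where
  "scal c = Poly_Mapping.single 0 c"

definition perm_elt :: "nat perm \<Rightarrow> 'x tw_alg" where
  "perm_elt \<sigma> = Poly_Mapping.single (Tw \<sigma> 0) 1"

lift_definition tuple :: "nat \<Rightarrow> (nat \<Rightarrow> 'x mon) \<Rightarrow> (nat \<Rightarrow>\<^sub>0 'x mon)"
  is "\<lambda>n M j. if j \<in> {1..n} then M j else 0"
  by (rule finite_subset[of _ "{1..n}" for n]) auto

definition tensor :: "nat \<Rightarrow> (nat \<Rightarrow> 'x mon) \<Rightarrow> 'x tw_alg" where
  "tensor n M = Poly_Mapping.single (Tw 1 (tuple n M)) 1"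

text \<open>The algebra \<open>\<T>(X,n)\<close>; for \<open>n = 0\<close> it consists of the scalars \<open>\<rat>[tr(M)]\<close>.\<close>

definition tw_basis :: "nat \<Rightarrow> 'x tw set" where
  "tw_basis n = {Tw \<sigma> M | \<sigma> M. \<sigma> \<in> Sym n \<and> Poly_Mapping.keys M \<subseteq> {1..n}}"

definition TX :: "nat \<Rightarrow> 'x tw_alg set" where
  "TX n = {a. Poly_Mapping.keys a \<subseteq> tw_basis n}"

text \<open>
  If \<open>\<sigma>\<close> does not fix \<open>n\<close>, then \<open>\<sigma> = \<tau> (n,i)\<close> with \<open>\<tau> \<in> S\<^bsub>n-1\<^esub>\<close> forces \<open>i = \<sigma>\<^sup>-\<^sup>1(n)\<close> and
  \<open>\<tau> = \<sigma> (n,i)\<close>.  The defining equations of the partial trace are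
  \<open>partial_trace_fix\<close> and \<open>partial_trace_swap\<close> below.
\<close>

fun partial_trace_basis :: "nat \<Rightarrow> 'x tw \<Rightarrow> 'x tw_alg" where
  "partial_trace_basis n (Tw \<sigma> M) =
     (let i = inverse \<sigma> \<langle>$\<rangle> n; m = Poly_Mapping.lookup M in
      if i = n then scal (tr (m n)) * (perm_elt \<sigma> * tensor (n - 1) m)
      else perm_elt (\<sigma> * \<langle>n \<leftrightarrow> i\<rangle>) * tensor (n - 1) (m(i := m n + m i)))"

definition partial_trace :: "nat \<Rightarrow> 'x tw_alg \<Rightarrow> 'x tw_alg" where
  "partial_trace n a =
     (\<Sum>b\<in>Poly_Mapping.keys a. scal (Poly_Mapping.lookup a b) * partial_trace_basis n b)"

lemma finite_Sym: "finite (Sym n)"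
proof (rule finite_imageD)
  show "inj_on apply (Sym n)"
    by (auto intro!: inj_onI perm_eqI)
  have "apply ` Sym n \<subseteq> {p. p permutes {1..n}}"
    by (auto simp: Sym_def in_affected permutes_def subset_iff bij_iff)
      (metis bij_apply bij_pointE)+
  then show "finite (apply ` Sym n)"
    by (rule finite_subset) (simp add: finite_permutations)
qed

lemma lookup_tuple [simp]:
  "Poly_Mapping.lookup (tuple n M) = (\<lambda>j. if j \<in> {1..n} then M j else 0)"
  by (rule tuple.rep_eq)

lemma tuple_cong: "(\<And>j. j \<in> {1..n} \<Longrightarrow> M j = N j) \<Longrightarrow> tuple n M = tuple n N"
  by (rule poly_mapping_eqI) auto

lemma tensor_cong: "(\<And>j. j \<in> {1..n} \<Longrightarrow> M j = N j) \<Longrightarrow> tensor n M = tensor n N"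
  unfolding tensor_def by (metis tuple_cong)

lemma tuple_lookup:
  "Poly_Mapping.keys M \<subseteq> {1..n} \<Longrightarrow> tuple n (Poly_Mapping.lookup M) = M"
  by (rule poly_mapping_eqI) (auto simp: in_keys_iff subset_iff)

lemma tensor_mult: "tensor n M * tensor n N = tensor n (\<lambda>j. M j + N j)"
proof -
  have "tuple n M + tuple n N = tuple n (\<lambda>j. M j + N j)"
    by (rule poly_mapping_eqI) (simp add: lookup_add)
  then show ?thesis by (simp only: tensor_def mult_single plus_tw.simps map_key_apply_one) simp
qed

lemma perm_elt_mult: "perm_elt \<sigma> * perm_elt \<tau> = perm_elt (\<sigma> * \<tau>)"
  by (simp add: perm_elt_def mult_single inj_apply_perm)

lemma perm_elt_tensor: "perm_elt \<sigma> * tensor n M = Poly_Mapping.single (Tw \<sigma> (tuple n M)) 1"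
  by (simp add: perm_elt_def tensor_def mult_single)

lemma Sym_apply_in: "\<sigma> \<in> Sym n \<Longrightarrow> \<sigma> \<langle>$\<rangle> j \<in> {1..n} \<longleftrightarrow> j \<in> {1..n}"
  by (metis (no_types, lifting) Sym_def apply_affected in_affected mem_Collect_eq subset_iff)

lemma Sym_inverse: "\<sigma> \<in> Sym n \<Longrightarrow> inverse \<sigma> \<in> Sym n"
  by (simp add: Sym_def)

lemma Sym_mult: "\<sigma> \<in> Sym n \<Longrightarrow> \<tau> \<in> Sym n \<Longrightarrow> \<sigma> * \<tau> \<in> Sym n"
  unfolding Sym_def using affected_times[of \<sigma> \<tau>] by blast

lemma inverse_apply: "inverse \<sigma> \<langle>$\<rangle> (\<sigma> \<langle>$\<rangle> a) = a"
  by (simp add: apply_sequence)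

text \<open>The commutation relation of \<open>\<T>(X,n)\<close>.\<close>

lemma perm_elt_tensor_commute:
  assumes "\<sigma> \<in> Sym n"
  shows "perm_elt \<sigma> * tensor n M = tensor n (\<lambda>j. M (inverse \<sigma> \<langle>$\<rangle> j)) * perm_elt \<sigma>"
proof -
  have "Poly_Mapping.map_key (apply \<sigma>) (tuple n (\<lambda>j. M (inverse \<sigma> \<langle>$\<rangle> j))) = tuple n M"
    by (rule poly_mapping_eqI)
      (use Sym_apply_in[OF assms] in \<open>auto simp: map_key.rep_eq inj_apply_perm inverse_apply\<close>)
  then show ?thesis
    by (simp add: perm_elt_tensor) (simp add: perm_elt_def tensor_def mult_single)
qed

lemma scal_central: "scal c * a = a * scal c"
proof -
  have "scal c * Poly_Mapping.single b v = Poly_Mapping.single b v * scal c" for b v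
    by (simp add: scal_def mult_single mult.commute)
  moreover have "a = (\<Sum>b\<in>Poly_Mapping.keys a. Poly_Mapping.single b (Poly_Mapping.lookup a b))"
    by (rule poly_mapping_eqI)
      (simp add: lookup_sum lookup_single when_def sum.delta in_keys_iff)
  ultimately show ?thesis
    by (metis (no_types, lifting) sum.cong sum_distrib_left sum_distrib_right)
qed

lemma Sym_pred_inverse_fixes:
  assumes "\<tau> \<in> Sym (n - 1)" and "n \<ge> 1"
  shows "inverse \<tau> \<langle>$\<rangle> n = n"
proof -
  have "n \<notin> affected (inverse \<tau>)"
    using assms by (fastforce simp: Sym_def subset_iff)
  then show ?thesis by (simp only: in_affected not_not)
qed

lemma scal_add: "scal (u + v) = scal u + scal v"
  by (simp add: scal_def single_add)

lemma scal_mult: "scal (u * v) = scal u * scal v"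
  by (simp add: scal_def mult_single)

lemma partial_trace_eq_sum:
  assumes "finite A" and "Poly_Mapping.keys a \<subseteq> A"
  shows "partial_trace n a = (\<Sum>b\<in>A. scal (Poly_Mapping.lookup a b) * partial_trace_basis n b)"
  unfolding partial_trace_def
  by (rule sum.mono_neutral_left) (use assms in \<open>auto simp: in_keys_iff scal_def\<close>)

lemma partial_trace_add: "partial_trace n (a + b) = partial_trace n a + partial_trace n b"
proof -
  let ?A = "Poly_Mapping.keys a \<union> Poly_Mapping.keys b"
  show ?thesis
    using Poly_Mapping.keys_add[of a b]
    by (simp add: scal_add partial_trace_eq_sum[of ?A] lookup_add distrib_right sum.distrib)
qed

lemma lookup_scal_mult: "Poly_Mapping.lookup (scal c * a) b = c * Poly_Mapping.lookup a b"
  unfolding scal_def mult_map_scale_conv_mult[symmetric]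
  by (simp add: Poly_Mapping.map.rep_eq when_def)

lemma partial_trace_scal: "partial_trace n (scal c * a) = scal c * partial_trace n a"
proof -
  have "Poly_Mapping.keys (scal c * a) \<subseteq> Poly_Mapping.keys a"
    by (auto simp: in_keys_iff lookup_scal_mult)
  then show ?thesis
    by (simp add: partial_trace_eq_sum[of "Poly_Mapping.keys a"] lookup_scal_mult scal_mult
        sum_distrib_left mult.assoc)
qed

lemma partial_trace_single: "partial_trace n (Poly_Mapping.single b c) = scal c * partial_trace_basis n b"
  by (simp add: partial_trace_def scal_def)

text \<open>
  In the next two lemmas \<open>\<tau> \<in> S\<^bsub>n-1\<^esub>\<close>; for \<open>n = 1\<close> the first one says that \<open>\<t>\<close> is
  \<open>tr : T\<langle>X\<rangle> \<rightarrow> \<rat>[tr(M)]\<close>.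
\<close>

lemma partial_trace_fix:
  assumes "n \<ge> 1" and "\<tau> \<in> Sym (n - 1)"
  shows "partial_trace n (perm_elt \<tau> * tensor n M)
    = scal (tr (M n)) * (perm_elt \<tau> * tensor (n - 1) M)"
proof -
  have "inverse \<tau> \<langle>$\<rangle> n = n"
    using assms by (simp add: Sym_pred_inverse_fixes)
  moreover have "tensor (n - 1) (\<lambda>j. if Suc 0 \<le> j \<and> j \<le> n then M j else 0) = tensor (n - 1) M"
    by (rule tensor_cong) auto
  ultimately show ?thesis
    using assms(1) by (simp add: perm_elt_tensor[of \<tau> n] partial_trace_single Let_def)
      (simp add: scal_def)
qed

lemma partial_trace_swap:
  assumes "\<tau> \<in> Sym (n - 1)" and "1 \<le> i" and "i \<le> n - 1"
  shows "partial_trace n (perm_elt \<tau> * perm_elt \<langle>n \<leftrightarrow> i\<rangle> * tensor n M)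
    = perm_elt \<tau> * tensor (n - 1) (M(i := M n + M i))"
proof -
  have "inverse \<tau> \<langle>$\<rangle> n = n"
    using assms by (intro Sym_pred_inverse_fixes) auto
  then have *: "inverse (\<tau> * \<langle>n \<leftrightarrow> i\<rangle>) \<langle>$\<rangle> n = i" by (simp add: apply_times)
  define m where "m = (\<lambda>j. if j \<in> {1..n} then M j else 0)"
  have "tensor (n - 1) (m(i := m n + m i)) = tensor (n - 1) (M(i := M n + M i))"
    by (rule tensor_cong) (use assms in \<open>auto simp: m_def\<close>)
  moreover have "i \<noteq> n" using assms by auto
  moreover have "\<tau> * \<langle>n \<leftrightarrow> i\<rangle> * \<langle>n \<leftrightarrow> i\<rangle> = \<tau>" by (simp add: mult.assoc)
  ultimately show ?thesis
    unfolding perm_elt_mult perm_elt_tensor[of _ n] partial_trace_single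
      partial_trace_basis.simps * lookup_tuple m_def[symmetric] Let_def
    by (simp add: scal_def)
qed

lemma tw_basis_add:
  assumes "a \<in> tw_basis n" and "b \<in> tw_basis n"
  shows "a + b \<in> tw_basis n"
proof -
  obtain \<sigma> M \<tau> N where a: "a = Tw \<sigma> M" "\<sigma> \<in> Sym n" "Poly_Mapping.keys M \<subseteq> {1..n}"
    and b: "b = Tw \<tau> N" "\<tau> \<in> Sym n" "Poly_Mapping.keys N \<subseteq> {1..n}"
    using assms by (auto simp: tw_basis_def)
  have "Poly_Mapping.keys (Poly_Mapping.map_key (apply \<tau>) M) \<subseteq> {1..n}"
    using a(3) Sym_apply_in[OF b(2)] by (auto simp: keys_map_key inj_apply_perm)
  then have "Poly_Mapping.keys (Poly_Mapping.map_key (apply \<tau>) M + N) \<subseteq> {1..n}"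
    using b(3) Poly_Mapping.keys_add[of "Poly_Mapping.map_key (apply \<tau>) M" N] by blast
  then show ?thesis
    using a(1,2) b(1,2) by (auto simp: tw_basis_def Sym_mult)
qed

lemma zero_in_tw_basis: "0 \<in> tw_basis n"
  by (simp add: tw_basis_def zero_tw_def Sym_def)

lemma scal_in_TX: "scal c \<in> TX n"
  by (auto simp: TX_def scal_def zero_in_tw_basis)

lemma perm_elt_in_TX: "\<sigma> \<in> Sym n \<Longrightarrow> perm_elt \<sigma> \<in> TX n"
  by (auto simp: TX_def perm_elt_def tw_basis_def)

lemma tensor_in_TX: "tensor n M \<in> TX n"
  by (auto simp: TX_def tensor_def tw_basis_def Sym_def in_keys_iff split: if_splits)

lemma zero_in_TX: "0 \<in> TX n"
  by (simp add: TX_def)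

lemma add_in_TX: "a \<in> TX n \<Longrightarrow> b \<in> TX n \<Longrightarrow> a + b \<in> TX n"
  using Poly_Mapping.keys_add[of a b] by (auto simp: TX_def)

lemma diff_in_TX: "a \<in> TX n \<Longrightarrow> b \<in> TX n \<Longrightarrow> a - b \<in> TX n"
  using keys_diff[of a b] by (auto simp: TX_def)

lemma mult_in_TX:
  assumes "a \<in> TX n" and "b \<in> TX n"
  shows "a * b \<in> TX n"
  using assms keys_mult[of a b] tw_basis_add[of _ n] unfolding TX_def by blast

text \<open>The product over the cycles of \<open>\<sigma>\<close> includes the fixed points of \<open>\<sigma>\<close> in \<open>{1..r}\<close>.\<close>

definition t_perm :: "nat \<Rightarrow> nat perm \<Rightarrow> 'x \<Rightarrow> 'x tr_poly" where
  "t_perm r \<sigma> x = (\<Prod>c\<in>orbit \<sigma> ` {1..r}. tr (var_pow x (card c)))"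

definition sigma_tr :: "nat \<Rightarrow> 'x \<Rightarrow> 'x tr_poly" where
  "sigma_tr r x =
     rat_const (1 / fact r) * (\<Sum>\<sigma>\<in>Sym r. of_int (sign (apply \<sigma>)) * t_perm r \<sigma> x)"

definition T_sym :: "nat \<Rightarrow> nat \<Rightarrow> 'x \<Rightarrow> 'x tw_alg" where
  "T_sym i n x =
     (\<Sum>h \<in> {h \<in> {1..n} \<rightarrow>\<^sub>E UNIV. (\<Sum>j=1..n. h j) = i}. tensor n (\<lambda>j. var_pow x (h j)))"

lemma finite_T_sym_index:
  "finite {h \<in> {1..n::nat} \<rightarrow>\<^sub>E (UNIV :: nat set). (\<Sum>j=1..n. h j) = i}"
proof (rule finite_subset)
  show "{h \<in> {1..n} \<rightarrow>\<^sub>E UNIV. (\<Sum>j=1..n. h j) = i} \<subseteq> {1..n} \<rightarrow>\<^sub>E {..i}"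
  proof
    fix h assume h: "h \<in> {h \<in> {1..n} \<rightarrow>\<^sub>E (UNIV :: nat set). (\<Sum>j=1..n. h j) = i}"
    have "h j \<le> i" if "j \<in> {1..n}" for j
      proof -
      have "h j \<le> (\<Sum>j=1..n. h j)" using that by (intro member_le_sum) auto
      then show ?thesis using h by simp
    qed
    then show "h \<in> {1..n} \<rightarrow>\<^sub>E {..i}" using h by (auto simp: PiE_iff)
  qed
qed (simp add: finite_PiE)

text \<open>Only used for \<open>k \<le> d + 1\<close>; the second branch is the case \<open>k = d + 1\<close>.\<close>

definition C_elt :: "nat \<Rightarrow> nat \<Rightarrow> 'x \<Rightarrow> 'x tw_alg" where
  "C_elt k d x =
     (if k \<le> d then
        (let n = d + 1 - k in
         (\<Sum>\<tau>\<in>Sym n. of_int (sign (apply \<tau>)) * perm_elt \<tau>) *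
         (T_sym k n x + (\<Sum>j=1..k. (-1) ^ j * (scal (sigma_tr j x) * T_sym (k - j) n x))))
      else scal ((-1) ^ (d + 1) * sigma_tr (d + 1) x))"

lemma of_int_in_TX: "of_int m \<in> TX n"
  using scal_in_TX[of "of_int m" n] by (simp add: scal_def flip: single_of_int)

lemma sum_in_TX: "(\<And>i. i \<in> A \<Longrightarrow> f i \<in> TX n) \<Longrightarrow> (\<Sum>i\<in>A. f i) \<in> TX n"
  by (induction A rule: infinite_finite_induct) (auto simp: zero_in_TX add_in_TX)

lemma C_elt_in_TX: "C_elt k d x \<in> TX (d + 1 - k)"
proof -
  have "(-1) ^ j \<in> TX n" for j n
    using of_int_in_TX[of "(-1) ^ j" n] by simp
  then show ?thesis
    by (auto simp: C_elt_def T_sym_def Let_def scal_in_TX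
        intro!: mult_in_TX add_in_TX sum_in_TX of_int_in_TX perm_elt_in_TX tensor_in_TX)
qed

text \<open>
  Congruence modulo the two-sided ideal of \<open>\<T>(X,n)\<close> generated by \<open>tr(1) - d\<close>.
\<close>

definition two_sided_ideal :: "'a::ring_1 set \<Rightarrow> 'a set \<Rightarrow> bool" where
  "two_sided_ideal R I \<longleftrightarrow> I \<subseteq> R \<and> 0 \<in> I \<and> (\<forall>a\<in>I. \<forall>b\<in>I. a - b \<in> I) \<and>
     (\<forall>r\<in>R. \<forall>a\<in>I. r * a \<in> I \<and> a * r \<in> I)"

lemma two_sided_ideal_TX: "two_sided_ideal (TX n) (TX n)"
  by (auto simp: two_sided_ideal_def zero_in_TX diff_in_TX mult_in_TX)

definition tr_one_ideal :: "nat \<Rightarrow> nat \<Rightarrow> 'x tw_alg set" where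
  "tr_one_ideal d n = two_sided_ideal (TX n) hull {scal (tr 0 - of_nat d)}"

definition spec_eq :: "nat \<Rightarrow> nat \<Rightarrow> 'x tw_alg \<Rightarrow> 'x tw_alg \<Rightarrow> bool" where
  "spec_eq d n a b \<longleftrightarrow> a \<in> TX n \<and> b \<in> TX n \<and> a - b \<in> tr_one_ideal d n"

lemma tr_one_ideal_eq:
  "tr_one_ideal d n = {scal (tr 0 - of_nat d) * z | z :: 'x tw_alg. z \<in> TX n}"
    (is "_ = ?J")
proof
  let ?c = "scal (tr 0 - of_nat d) :: 'x tw_alg"
  have "two_sided_ideal (TX n) ?J"
    unfolding two_sided_ideal_def
  proof (intro conjI ballI)
    show "?J \<subseteq> TX n" by (auto simp: scal_in_TX mult_in_TX)
    show "0 \<in> ?J" using zero_in_TX[of n] by force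
    show "a - b \<in> ?J" if "a \<in> ?J" "b \<in> ?J" for a b
      using that by (force simp: right_diff_distrib[symmetric] intro: diff_in_TX)
    show "r * a \<in> ?J" "a * r \<in> ?J" if "r \<in> TX n" and a: "a \<in> ?J" for r a
    proof -
      obtain z where z: "a = ?c * z" "z \<in> TX n" using a by blast
      have "r * a = ?c * (r * z)" unfolding z(1) by (metis mult.assoc scal_central)
      then show "r * a \<in> ?J" using that(1) z(2) mult_in_TX by blast
      have "a * r = ?c * (z * r)" unfolding z(1) by (simp add: mult.assoc)
      then show "a * r \<in> ?J" using that(1) z(2) mult_in_TX by blast
    qed
  qed
  moreover have "?c \<in> ?J"
    using scal_in_TX[of 1 n] by (force simp: scal_def mult_single)
  ultimately show "tr_one_ideal d n \<subseteq> ?J"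
    unfolding tr_one_ideal_def by (intro hull_minimal) auto
  show "?J \<subseteq> tr_one_ideal d n"
    unfolding tr_one_ideal_def hull_def two_sided_ideal_def by blast
qed

end

theory Submission
  imports Defs
begin

text \<open>
  Splitting \<open>\<sigma> \<in> S\<^sub>n\<close> as \<open>\<tau>\<close> or \<open>\<tau> (n,i)\<close> with \<open>\<tau> \<in> S\<^bsub>n-1\<^esub>\<close> gives, for the antisymmetrizer \<open>A\<^sub>n\<close> and the power
  traces \<open>p\<^sub>m = tr(x\<^sup>m)\<close>,
  \<open>\<t>(A\<^sub>n T\<^bsub>i,n\<^esub>) = A\<^bsub>n-1\<^esub> (\<Sum>\<^sub>m p\<^sub>m T\<^bsub>i-m,n-1\<^esub> - (i + n - 1) T\<^bsub>i,n-1\<^esub>)\<close>: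
  a tuple of sum \<open>i\<close> arises by merging the last exponent into position \<open>j\<close> in \<open>h\<^sub>j + 1\<close> ways. After
  multiplication by \<open>1 \<otimes> \<dots> \<otimes> 1 \<otimes> x\<close> the analogous count is \<open>h\<^sub>j\<close>, so the result is
  \<open>A\<^bsub>n-1\<^esub> (\<Sum>\<^sub>m p\<^bsub>m+1\<^esub> T\<^bsub>i-m,n-1\<^esub> - (i + 1) T\<^bsub>i+1,n-1\<^esub>)\<close>. Since the \<open>\<sigma>\<^sub>j\<close> satisfy Newton's
  identities \<open>s \<sigma>\<^sub>s = \<Sum>\<^sub>m (-1)\<^bsup>m-1\<^esup> p\<^sub>m \<sigma>\<^bsub>s-m\<^esub>\<close>, the alternating sums collapse: the first trace becomes a
  multiple of \<open>tr(1) - d\<close>, and the second is equal to \<open>-(k+1) C\<^bsub>k+1,d\<^esub>\<close> even before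
  specializing. Newton's identities themselves follow from the same splitting of permutations.
\<close>

subsection \<open>Signed sums of cycle weights\<close>

text \<open>Arbitrary carriers are needed because the induction behind Newton's identities removes
  an arbitrary point of the set, not just the largest one.\<close>

definition perms_on :: "'a set \<Rightarrow> 'a perm set" where
  "perms_on A = {\<sigma>. affected \<sigma> \<subseteq> A}"

lemma Sym_eq_perms_on: "Sym n = perms_on {1..n}"
  by (simp add: Sym_def perms_on_def)

lemma perms_on_apply_outside: "\<sigma> \<in> perms_on A \<Longrightarrow> b \<notin> A \<Longrightarrow> \<sigma> \<langle>$\<rangle> b = b"
  by (metis (mono_tags, lifting) in_affected in_mono mem_Collect_eq perms_on_def)

lemma perms_on_empty: "perms_on {} = {1}"
  by (auto simp: perms_on_def)

text \<open>Each permutation of \<open>insert b A\<close> is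
  \<open>\<tau> * \<langle>b \<leftrightarrow> i\<rangle>\<close> for exactly one
  \<open>\<tau>\<close> fixing \<open>b\<close>, where \<open>i\<close> is the preimage of
  \<open>b\<close>. The choice \<open>i = b\<close> makes the swap trivial and gives the first
  sum.\<close>

lemma sum_perms_on_insert:
  fixes f :: "'a perm \<Rightarrow> 'b::comm_monoid_add"
  assumes "finite A" and "b \<notin> A"
  shows "(\<Sum>\<sigma>\<in>perms_on (insert b A). f \<sigma>)
    = (\<Sum>\<tau>\<in>perms_on A. f \<tau>) + (\<Sum>i\<in>A. \<Sum>\<tau>\<in>perms_on A. f (\<tau> * \<langle>b \<leftrightarrow> i\<rangle>))"
proof -
  have "(\<Sum>\<sigma>\<in>perms_on (insert b A). f \<sigma>)
    = (\<Sum>(i, \<tau>)\<in>insert b A \<times> perms_on A. f (\<tau> * \<langle>b \<leftrightarrow> i\<rangle>))"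
  proof (rule sum.reindex_bij_witness[where
        j = "\<lambda>\<sigma>. (inverse \<sigma> \<langle>$\<rangle> b, \<sigma> * \<langle>b \<leftrightarrow> inverse \<sigma> \<langle>$\<rangle> b\<rangle>)" and
        i = "\<lambda>(i, \<tau>). \<tau> * \<langle>b \<leftrightarrow> i\<rangle>"], goal_cases)
    case (1 \<sigma>)
    then show ?case by (simp add: mult.assoc)
  next
    case (2 \<sigma>)
    let ?i = "inverse \<sigma> \<langle>$\<rangle> b"
    have i: "?i \<in> insert b A"
    proof (rule ccontr)
      assume "?i \<notin> insert b A"
      then have "\<sigma> \<langle>$\<rangle> ?i = ?i" using 2 perms_on_apply_outside by metis
      then show False using \<open>?i \<notin> insert b A\<close> by (simp add: apply_sequence)
    qed
    have si: "\<sigma> \<langle>$\<rangle> ?i = b" by (simp add: apply_sequence)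
    have "(\<sigma> * \<langle>b \<leftrightarrow> ?i\<rangle>) \<langle>$\<rangle> a = a" if "a \<notin> A" for a
    proof (cases "a = b")
      case True
      then show ?thesis using si by (simp add: apply_times)
    next
      case False
      then have "a \<noteq> ?i" using that i by auto
      then show ?thesis using False that 2 by (simp add: apply_times perms_on_apply_outside)
    qed
    then have "\<sigma> * \<langle>b \<leftrightarrow> ?i\<rangle> \<in> perms_on A"
      unfolding perms_on_def using in_affected[of _ "\<sigma> * \<langle>b \<leftrightarrow> ?i\<rangle>"] by (metis mem_Collect_eq subsetI)
    then show ?case using i by simp
  next
    case (3 z)
    then obtain i \<tau> where z: "z = (i, \<tau>)" "i \<in> insert b A" "\<tau> \<in> perms_on A" by auto
    have "inverse \<tau> \<langle>$\<rangle> b = b"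
      using z(3) assms(2) perms_on_apply_outside[of "inverse \<tau>" A b]
      by (simp add: perms_on_def)
    then show ?case by (simp add: z(1) apply_times mult.assoc)
  next
    case (4 z)
    then obtain i \<tau> where z: "z = (i, \<tau>)" "i \<in> insert b A" "\<tau> \<in> perms_on A" by auto
    have "affected (\<tau> * \<langle>b \<leftrightarrow> i\<rangle>) \<subseteq> insert b A"
      using affected_times[of \<tau> "\<langle>b \<leftrightarrow> i\<rangle>"] z(2,3)
      by (cases "b = i") (auto simp: perms_on_def affected_swap)
    then show ?case by (simp add: z(1) perms_on_def)
  next
    case (5 \<sigma>)
    then show ?case by (simp add: mult.assoc)
  qed
  also have "\<dots> = (\<Sum>i\<in>insert b A. \<Sum>\<tau>\<in>perms_on A. f (\<tau> * \<langle>b \<leftrightarrow> i\<rangle>))"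
    by (simp add: sum.cartesian_product)
  finally show ?thesis using assms by simp
qed

lemma permutation_apply: "permutation (apply \<sigma>)"
  using finite_affected[of \<sigma>] by (simp add: permutation affected_def)

lemma sign_mult_swap: "b \<noteq> i \<Longrightarrow> sign (apply (\<tau> * \<langle>b \<leftrightarrow> i\<rangle>)) = - sign (apply \<tau>)"
proof -
  assume "b \<noteq> i"
  moreover have "apply \<langle>b \<leftrightarrow> i\<rangle> = transpose b i" by transfer simp
  ultimately show ?thesis
    by (simp add: times_perm.rep_eq sign_compose permutation_apply permutation_swap_id sign_swap_id)
qed

lemma orbit_subsetI:
  assumes "a \<in> S" and "\<And>j. j \<in> S \<Longrightarrow> \<sigma> \<langle>$\<rangle> j \<in> S"
  shows "orbit \<sigma> a \<subseteq> S"
proof -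
  have "(\<sigma> ^ n) \<langle>$\<rangle> a \<in> S" for n
    by (induction n) (use assms in \<open>auto simp: apply_times\<close>)
  then show ?thesis by (auto simp: orbit_def)
qed

lemma orbit_closed: "j \<in> orbit \<sigma> a \<Longrightarrow> \<sigma> \<langle>$\<rangle> j \<in> orbit \<sigma> a"
  by (auto simp: orbit_def apply_sequence simp flip: power_Suc)

lemma orbit_perms_on: "\<sigma> \<in> perms_on A \<Longrightarrow> a \<in> A \<Longrightarrow> orbit \<sigma> a \<subseteq> A"
  by (rule orbit_subsetI) (auto simp: perms_on_def dest: subsetD, metis apply_affected in_affected subset_iff)

text \<open>
  Weights on the points are kept general because the recursion \<open>cyc_sum_insert\<close>, which removes a point
  and adds its weight to another point of its cycle, leaves the case of weights \<open>1\<close>.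
\<close>

definition cyc_wt :: "(nat \<Rightarrow> 'r::comm_ring_1) \<Rightarrow> 'a set \<Rightarrow> ('a \<Rightarrow> nat) \<Rightarrow> 'a perm \<Rightarrow> 'r" where
  "cyc_wt p A w \<sigma> = (\<Prod>c\<in>orbit \<sigma> ` A. p (\<Sum>j\<in>c. w j))"

definition cyc_sum :: "(nat \<Rightarrow> 'r::comm_ring_1) \<Rightarrow> 'a set \<Rightarrow> ('a \<Rightarrow> nat) \<Rightarrow> 'r" where
  "cyc_sum p A w = (\<Sum>\<sigma>\<in>perms_on A. of_int (sign (apply \<sigma>)) * cyc_wt p A w \<sigma>)"

lemma cyc_wt_insert_fixed:
  assumes "finite A" and "b \<notin> A" and "\<tau> \<in> perms_on A"
  shows "cyc_wt p (insert b A) w \<tau> = p (w b) * cyc_wt p A w \<tau>"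
proof -
  have "orbit \<tau> b = {b}"
    using perms_on_apply_outside[OF assms(3,2)] not_in_affected_iff_orbit_eq_singleton[of b \<tau>]
    by (simp add: in_affected)
  moreover have "{b} \<notin> orbit \<tau> ` A"
    using orbit_perms_on[OF assms(3)] assms(2) by blast
  ultimately show ?thesis
    using assms(1) by (simp add: cyc_wt_def)
qed

text \<open>Right multiplication by the swap splices \<open>b\<close> into the cycle of
  \<open>i\<close> directly after \<open>i\<close>, so that \<open>i\<close> goes to
  \<open>b\<close> and \<open>b\<close> to \<open>\<tau> \<langle>$\<rangle> i\<close>; all other
  cycles stay as they are.\<close>

lemma orbits_insert_swap:
  assumes "b \<notin> A" and "i \<in> A" and "\<tau> \<in> perms_on A"
  shows "orbit (\<tau> * \<langle>b \<leftrightarrow> i\<rangle>) ` insert b A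
    = insert (insert b (orbit \<tau> i)) (orbit \<tau> ` A - {orbit \<tau> i})"
proof -
  let ?\<sigma> = "\<tau> * \<langle>b \<leftrightarrow> i\<rangle>"
  let ?C = "orbit \<tau> i"
  have \<tau>b: "\<tau> \<langle>$\<rangle> b = b" using assms perms_on_apply_outside by metis
  have \<sigma>b: "?\<sigma> \<langle>$\<rangle> b = \<tau> \<langle>$\<rangle> i" and \<sigma>i: "?\<sigma> \<langle>$\<rangle> i = b"
    by (simp_all add: apply_times \<tau>b)
  have \<sigma>j: "?\<sigma> \<langle>$\<rangle> j = \<tau> \<langle>$\<rangle> j" if "j \<noteq> b" "j \<noteq> i" for j
    using that by (simp add: apply_times)
  have "b \<noteq> i" using assms by auto
  have \<tau>nb: "\<tau> \<langle>$\<rangle> j \<noteq> b" if "j \<noteq> b" for j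
    using that \<tau>b injD[OF inj_apply_perm, of \<tau> j b] by auto
  have Ci: "orbit ?\<sigma> i = insert b ?C"
  proof (rule equalityI)
    show "orbit ?\<sigma> i \<subseteq> insert b ?C"
    proof (rule orbit_subsetI)
      fix j assume "j \<in> insert b ?C"
      then show "?\<sigma> \<langle>$\<rangle> j \<in> insert b ?C"
        using \<sigma>b \<sigma>i \<sigma>j[of j] orbit_closed[of _ \<tau> i]
        by (cases "j = b"; cases "j = i") auto
    qed simp
    have b: "b \<in> orbit ?\<sigma> i" using \<sigma>i by (metis apply_self_in_orbit)
    \<comment> \<open>Skipping \<open>b\<close> leaves a set closed under \<open>\<tau>\<close>:
      only at \<open>i\<close> do the maps differ there, and
      \<open>\<tau> \<langle>$\<rangle> i\<close> is reached from \<open>i\<close> by two steps of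
      \<open>?\<sigma>\<close>.\<close>
    have "?C \<subseteq> orbit ?\<sigma> i - {b}"
    proof (rule orbit_subsetI)
      fix j assume j: "j \<in> orbit ?\<sigma> i - {b}"
      show "\<tau> \<langle>$\<rangle> j \<in> orbit ?\<sigma> i - {b}"
      proof (cases "j = i")
        case True
        then show ?thesis using j \<tau>nb[of j] \<sigma>b orbit_closed[OF b] by auto
      next
        case False
        then show ?thesis using j \<tau>nb[of j] \<sigma>j[of j] orbit_closed[of j ?\<sigma> i] by auto
      qed
    qed (use \<open>b \<noteq> i\<close> in auto)
    then show "insert b ?C \<subseteq> orbit ?\<sigma> i" using b by auto
  qed
  have Cb: "orbit ?\<sigma> b = insert b ?C"
    using Ci orbit_equiv[of b ?\<sigma> i] by blast
  have Cj: "orbit ?\<sigma> j = (if j \<in> ?C then insert b ?C else orbit \<tau> j)" if "j \<in> A" for j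
  proof (cases "j \<in> ?C")
    case True
    then show ?thesis using Ci orbit_equiv[of j ?\<sigma> i] by auto
  next
    case False
    \<comment> \<open>Away from \<open>i\<close> and \<open>b\<close> the two permutations agree, so
      an orbit of one that avoids both points is closed under the other.\<close>
    have o\<tau>: "i \<notin> orbit \<tau> j" using False orbit_equiv[of i \<tau> j] by fastforce
    have "b \<notin> orbit \<tau> j" using orbit_perms_on[OF assms(3) that] assms(1) by auto
    then have "orbit ?\<sigma> j \<subseteq> orbit \<tau> j"
      using o\<tau> \<sigma>j orbit_closed[of _ \<tau> j] by (intro orbit_subsetI) (simp, metis)
    moreover have "i \<notin> orbit ?\<sigma> j" "b \<notin> orbit ?\<sigma> j"
      using calculation o\<tau> \<open>b \<notin> orbit \<tau> j\<close> by auto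
    then have "orbit \<tau> j \<subseteq> orbit ?\<sigma> j"
      using \<sigma>j orbit_closed[of _ ?\<sigma> j] by (intro orbit_subsetI) (simp, metis)
    ultimately show ?thesis using False by auto
  qed
  have eqC: "orbit \<tau> j = ?C \<longleftrightarrow> j \<in> ?C" for j
    by (metis orbit_equiv in_orbit_self)
  show ?thesis
  proof (rule equalityI)
    show "orbit ?\<sigma> ` insert b A \<subseteq> insert (insert b ?C) (orbit \<tau> ` A - {?C})"
      using Cb Cj eqC by auto
    have "orbit \<tau> j \<in> orbit ?\<sigma> ` insert b A" if "j \<in> A" "orbit \<tau> j \<noteq> ?C" for j
      using that Cj[of j] eqC[of j] by (metis image_eqI insertI2)
    moreover have "insert b ?C \<in> orbit ?\<sigma> ` insert b A"
      using Cb by (metis image_eqI insertI1)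
    ultimately show "insert (insert b ?C) (orbit \<tau> ` A - {?C}) \<subseteq> orbit ?\<sigma> ` insert b A"
      by (simp only: insert_subset subset_iff) blast
  qed
qed

text \<open>Moving the weight of \<open>b\<close> onto \<open>i\<close> keeps the total weight of
  their common cycle and does not touch the other cycles.\<close>

lemma cyc_wt_insert_swap:
  assumes "finite A" and "b \<notin> A" and "i \<in> A" and "\<tau> \<in> perms_on A"
  shows "cyc_wt p (insert b A) w (\<tau> * \<langle>b \<leftrightarrow> i\<rangle>) = cyc_wt p A (w(i := w b + w i)) \<tau>"
proof -
  let ?C = "orbit \<tau> i" and ?w = "w(i := w b + w i)"
  let ?R = "orbit \<tau> ` A - {?C}"
  have bR: "b \<notin> c" if "c \<in> orbit \<tau> ` A" for c
    using orbit_perms_on[OF assms(4)] assms(2) that by auto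
  then have "b \<notin> ?C" using assms(3) by auto
  have "(\<Sum>j\<in>?C. ?w j) = ?w i + (\<Sum>j\<in>?C - {i}. ?w j)"
    by (rule sum.remove) auto
  also have "\<dots> = w b + (w i + (\<Sum>j\<in>?C - {i}. w j))"
    by (auto intro: sum.cong)
  also have "w i + (\<Sum>j\<in>?C - {i}. w j) = (\<Sum>j\<in>?C. w j)"
    by (rule sum.remove[symmetric]) auto
  finally have C: "(\<Sum>j\<in>?C. ?w j) = (\<Sum>j\<in>insert b ?C. w j)"
    using \<open>b \<notin> ?C\<close> by simp
  have R: "(\<Sum>j\<in>c. ?w j) = (\<Sum>j\<in>c. w j)" if "c \<in> ?R" for c
  proof (rule sum.cong)
    fix j assume "j \<in> c"
    have "i \<notin> c" using that orbit_equiv[of i \<tau>] by auto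
    then show "?w j = w j" using \<open>j \<in> c\<close> by auto
  qed simp
  \<comment> \<open>The enlarged cycle is a new element of the set of cycles, so it contributes a
    factor of its own.\<close>
  have "insert b ?C \<notin> ?R" using bR by blast
  then have "cyc_wt p (insert b A) w (\<tau> * \<langle>b \<leftrightarrow> i\<rangle>)
      = p (\<Sum>j\<in>insert b ?C. w j) * (\<Prod>c\<in>?R. p (\<Sum>j\<in>c. w j))"
    unfolding cyc_wt_def orbits_insert_swap[OF assms(2-4)]
    using assms(1) by (subst prod.insert) auto
  also have "\<dots> = p (\<Sum>j\<in>?C. ?w j) * (\<Prod>c\<in>?R. p (\<Sum>j\<in>c. ?w j))"
    using C R by simp
  also have "\<dots> = cyc_wt p A ?w \<tau>"
    unfolding cyc_wt_def using assms(1,3) by (intro prod.remove[symmetric]) auto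
  finally show ?thesis .
qed

text \<open>If \<open>b\<close> is fixed, it is a cycle by itself with factor
  \<open>p (w b)\<close>; otherwise the swap flips the sign and \<open>b\<close> is merged into some
  \<open>i\<close>.\<close>

lemma cyc_sum_insert:
  assumes "finite A" and "b \<notin> A"
  shows "cyc_sum p (insert b A) w
    = p (w b) * cyc_sum p A w - (\<Sum>i\<in>A. cyc_sum p A (w(i := w b + w i)))"
proof -
  have "(\<Sum>\<tau>\<in>perms_on A. of_int (sign (apply (\<tau> * \<langle>b \<leftrightarrow> i\<rangle>))) * cyc_wt p (insert b A) w (\<tau> * \<langle>b \<leftrightarrow> i\<rangle>))
      = - cyc_sum p A (w(i := w b + w i))" if "i \<in> A" for i
  proof -
    have "b \<noteq> i" using that assms by auto
    then show ?thesis
      using assms that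
      by (simp add: cyc_sum_def sign_mult_swap cyc_wt_insert_swap sum_negf)
  qed
  then show ?thesis
    using assms unfolding cyc_sum_def[of p "insert b A"]
    by (simp add: sum_perms_on_insert cyc_wt_insert_fixed cyc_sum_def[of p A w] sum_distrib_left
        mult.left_commute sum_negf)
qed

subsection \<open>Newton's identities\<close>

lemma rat_const_mult: "rat_const q * rat_const r = (rat_const (q * r) :: 'x tr_poly)"
  by (simp add: rat_const_def mult_single)

lemma rat_const_of_nat: "(of_nat m :: 'x tr_poly) = rat_const (of_nat m)"
  by (simp add: rat_const_def flip: single_of_nat)

text \<open>For power sums \<open>p\<close> this is the cycle expansion of the elementary symmetric
  polynomial. Keeping \<open>p\<close> arbitrary makes Newton's identities formal.\<close>

definition elem_sym :: "(nat \<Rightarrow> 'x tr_poly) \<Rightarrow> nat \<Rightarrow> 'x tr_poly" where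
  "elem_sym p r = rat_const (1 / fact r) * cyc_sum p {1..r} (\<lambda>_. 1)"

lemma rat_const_inverse_fact:
  "rat_const (1 / fact N) = rat_const (1 / fact (Suc N)) * (of_nat (Suc N) :: 'x tr_poly)"
proof -
  have "1 / fact N = 1 / fact (Suc N) * (of_nat (Suc N) :: rat)"
    by (simp del: of_nat_Suc)
  then show ?thesis by (simp only: rat_const_of_nat rat_const_mult)
qed

lemma rat_const_inverse_fact_Suc:
  "rat_const (1 / fact (Suc N)) = (rat_const (1 / of_nat (Suc N)) * rat_const (1 / fact N) :: 'x tr_poly)"
  unfolding rat_const_mult by simp

lemma cyc_sum_empty: "cyc_sum p {} w = 1"
  by (simp add: cyc_sum_def perms_on_empty cyc_wt_def)

lemma rat_const_1: "rat_const 1 = 1"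
  by (simp add: rat_const_def)

text \<open>
  The marked statement cannot be proved by itself: absorbing \<open>b\<close> into the cycle of \<open>i \<in> A\<close> marks \<open>i\<close>
  with a larger weight, and the leftover unmarked sums over arbitrary \<open>A\<close> must be known to depend
  only on \<open>card A\<close>, which is the other half of the induction.
\<close>

lemma cyc_sum_ones_and_marked:
  fixes p :: "nat \<Rightarrow> 'x tr_poly" and A :: "nat set"
  shows "finite A \<Longrightarrow> card A = N \<Longrightarrow> (\<And>j. j \<in> A \<Longrightarrow> w j = 1) \<Longrightarrow>
      rat_const (1 / fact N) * cyc_sum p A w = elem_sym p N"
    and "finite A \<Longrightarrow> card A = N \<Longrightarrow> b \<notin> A \<Longrightarrow> (\<And>j. j \<in> A \<Longrightarrow> w j = 1) \<Longrightarrow>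
      rat_const (1 / fact N) * cyc_sum p (insert b A) w
      = (\<Sum>m\<le>N. (-1) ^ m * (p (w b + m) * elem_sym p (N - m)))"
proof (induction N arbitrary: A b w)
  case 0
  {
    case 1
    then have "A = {}" by simp
    then show ?case by (simp add: cyc_sum_empty elem_sym_def)
  next
    case 2
    then have "A = {}" by simp
    then show ?case
      using cyc_sum_insert[of "{}" b p w] by (simp add: cyc_sum_empty elem_sym_def rat_const_1)
  }
next
  case (Suc N)
  let ?S = "\<lambda>a. \<Sum>m\<le>N. (-1) ^ m * (p (a + m) * elem_sym p (N - m))"
  \<comment> \<open>Any \<open>i \<in> A\<close> can serve as the marked point of the induction
    hypothesis for \<open>A - {i}\<close>.\<close>
  have marked: "rat_const (1 / fact N) * cyc_sum p A w = ?S (w i)"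
    if "finite A" "card A = Suc N" "i \<in> A" "\<And>j. j \<in> A - {i} \<Longrightarrow> w j = 1" for A :: "nat set" and w i
    using Suc.IH(2)[of "A - {i}" i w] that by (simp add: insert_absorb)
  \<comment> \<open>The right-hand side mentions neither \<open>A\<close> nor \<open>w\<close>, so
    the set \<open>{1..Suc N}\<close> in \<open>elem_sym\<close> can stand for every set of this
    size.\<close>
  have ones: "rat_const (1 / fact (Suc N)) * cyc_sum p A w = rat_const (1 / of_nat (Suc N)) * ?S 1"
    if A: "finite A" "card A = Suc N" "\<And>j. j \<in> A \<Longrightarrow> w j = 1" for A :: "nat set" and w
  proof -
    obtain i where i: "i \<in> A" using A by fastforce
    show ?thesis
      unfolding rat_const_inverse_fact_Suc mult.assoc using marked[OF A(1,2) i] A(3) i by simp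
  qed
  {
    case 1
    have "elem_sym p (Suc N) = rat_const (1 / of_nat (Suc N)) * ?S 1"
      unfolding elem_sym_def[of p "Suc N"] by (rule ones) auto
    then show ?case using ones[OF 1] by simp
  next
    case 2
    note A = 2
    have *: "rat_const (1 / fact (Suc N)) * cyc_sum p A w = elem_sym p (Suc N)"
      using ones[of A w] ones[of "{1..Suc N}" "\<lambda>_. 1"] A unfolding elem_sym_def[of p "Suc N"] by simp
    \<comment> \<open>After the merge only \<open>i\<close> has a weight other than 1, namely
      \<open>w b + 1\<close>. All \<open>N + 1\<close> choices of \<open>i\<close> thus give the
      same value, and this factor cancels against the larger factorial.\<close>
    have "rat_const (1 / fact N) * cyc_sum p A (w(i := w b + w i)) = ?S (Suc (w b))" if "i \<in> A" for i
      using marked[of A i "w(i := w b + w i)"] A that by simp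
    then have "rat_const (1 / fact N) * (\<Sum>i\<in>A. cyc_sum p A (w(i := w b + w i)))
        = of_nat (Suc N) * ?S (Suc (w b))"
      using A(2) by (simp add: sum_distrib_left del: of_nat_Suc)
    then have "rat_const (1 / of_nat (Suc N)) * (rat_const (1 / fact N) * (\<Sum>i\<in>A. cyc_sum p A (w(i := w b + w i))))
        = ?S (Suc (w b))"
      by (simp add: rat_const_of_nat rat_const_mult rat_const_1 mult.assoc[symmetric] del: of_nat_Suc)
    then have **: "rat_const (1 / fact (Suc N)) * (\<Sum>i\<in>A. cyc_sum p A (w(i := w b + w i)))
        = ?S (Suc (w b))"
      by (simp only: rat_const_inverse_fact_Suc mult.assoc)
    have "rat_const (1 / fact (Suc N)) * cyc_sum p (insert b A) w
        = p (w b) * elem_sym p (Suc N) - ?S (Suc (w b))"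
      unfolding cyc_sum_insert[OF A(1,3)] right_diff_distrib ** *[symmetric]
      by (simp add: mult.left_commute)
    also have "\<dots> = (\<Sum>m\<le>Suc N. (-1) ^ m * (p (w b + m) * elem_sym p (Suc N - m)))"
      unfolding sum.atMost_Suc_shift by (simp add: sum_negf)
    finally show ?case .
  }
qed

text \<open>The marked formula with \<open>b = Suc s\<close> and all weights 1, read backwards via
  \<open>j = s - m\<close>; the signs agree because \<open>s + (s - j)\<close> and \<open>j\<close>
  have the same parity.\<close>

lemma newton_identity:
  "(\<Sum>j\<le>s. (-1) ^ j * (elem_sym p j * p (Suc s - j)))
    = (-1) ^ s * (of_nat (Suc s) * elem_sym p (Suc s))"
proof -
  have "of_nat (Suc s) * elem_sym p (Suc s) = rat_const (1 / fact s) * cyc_sum p (insert (Suc s) {1..s}) (\<lambda>_. 1)"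
    unfolding rat_const_inverse_fact[of s] elem_sym_def by (simp only: mult_ac atLeastAtMostSuc_conv)
  also have "\<dots> = (\<Sum>m\<le>s. (-1) ^ m * (p (1 + m) * elem_sym p (s - m)))"
    by (rule cyc_sum_ones_and_marked) auto
  also have "\<dots> = (\<Sum>j\<le>s. (-1) ^ (s - j) * (p (Suc s - j) * elem_sym p j))"
    by (rule sum.reindex_bij_witness[where i = "\<lambda>j. s - j" and j = "\<lambda>j. s - j"]) (auto simp: Suc_diff_le)
  finally have "(-1) ^ s * (of_nat (Suc s) * elem_sym p (Suc s))
      = (\<Sum>j\<le>s. (-1) ^ s * (-1) ^ (s - j) * (p (Suc s - j) * elem_sym p j))"
    by (simp add: sum_distrib_left mult.assoc)
  also have "\<dots> = (\<Sum>j\<le>s. (-1) ^ j * (elem_sym p j * p (Suc s - j)))"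
  proof (rule sum.cong)
    fix j assume "j \<in> {..s}"
    then obtain t where "s = j + t" by (auto simp: le_iff_add)
    then show "(-1) ^ s * (-1) ^ (s - j) * (p (Suc s - j) * elem_sym p j)
        = (-1) ^ j * (elem_sym p j * p (Suc s - j))"
      by (cases "even j"; cases "even t") (simp_all add: mult.commute)
  qed simp
  finally show ?thesis by simp
qed

text \<open>With unit weights the weight of a cycle is its length.\<close>

lemma sigma_tr_eq_elem_sym: "sigma_tr r x = elem_sym (\<lambda>m. tr (var_pow x m)) r"
  by (simp add: sigma_tr_def elem_sym_def cyc_sum_def cyc_wt_def t_perm_def Sym_eq_perms_on)

subsection \<open>The partial trace of antisymmetrized tensors\<close>

lemma of_int_eq_scal: "(of_int m :: 'x tw_alg) = scal (of_int m)"
  by (simp add: scal_def flip: single_of_int)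

lemma of_nat_eq_scal: "(of_nat m :: 'x tw_alg) = scal (of_nat m)"
  by (simp add: scal_def flip: single_of_nat)

lemma scal_0: "scal 0 = 0"
  by (simp add: scal_def)

lemma scal_1: "scal 1 = 1"
  by (simp add: scal_def)

lemma scal_diff: "scal (u - v) = scal u - scal v"
  by (simp add: scal_def single_diff)

lemma scal_sum: "scal (\<Sum>i\<in>A. f i) = (\<Sum>i\<in>A. scal (f i))"
  by (induction A rule: infinite_finite_induct) (auto simp: scal_0 scal_add)

lemma scal_left_commute: "a * (scal c * b) = scal c * (a * b)"
  by (simp only: mult.assoc[symmetric] scal_central[of c a])

lemma partial_trace_sum: "partial_trace n (\<Sum>i\<in>A. f i) = (\<Sum>i\<in>A. partial_trace n (f i))"
proof -
  have "partial_trace n 0 = 0" by (simp add: partial_trace_def)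
  then show ?thesis
    by (induction A rule: infinite_finite_induct) (auto simp: partial_trace_add)
qed

definition antisymmetrizer :: "nat \<Rightarrow> 'x tw_alg" where
  "antisymmetrizer n = (\<Sum>\<tau>\<in>Sym n. of_int (sign (apply \<tau>)) * perm_elt \<tau>)"

text \<open>The splitting of \<open>Sym (Suc n)\<close> matches the two defining equations of the
  partial trace; the transposition accounts for the minus sign.\<close>

lemma partial_trace_antisymmetrizer:
  "partial_trace (Suc n) (antisymmetrizer (Suc n) * tensor (Suc n) M)
    = antisymmetrizer n * (scal (tr (M (Suc n))) * tensor n M
        - (\<Sum>i=1..n. tensor n (M(i := M (Suc n) + M i))))"
proof -
  let ?f = "\<lambda>\<sigma>. of_int (sign (apply \<sigma>)) * partial_trace (Suc n) (perm_elt \<sigma> * tensor (Suc n) M)"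
  let ?A = "{1..n}"
  have S: "Sym n = perms_on ?A" "Sym (Suc n) = perms_on (insert (Suc n) ?A)"
    by (simp_all add: Sym_eq_perms_on atLeastAtMostSuc_conv)
  have fixed: "(\<Sum>\<tau>\<in>Sym n. ?f \<tau>) = antisymmetrizer n * (scal (tr (M (Suc n))) * tensor n M)"
    using partial_trace_fix[of "Suc n" _ M]
    by (simp add: antisymmetrizer_def sum_distrib_right sum_distrib_left mult.assoc scal_left_commute)
  have swap: "(\<Sum>\<tau>\<in>Sym n. ?f (\<tau> * \<langle>Suc n \<leftrightarrow> i\<rangle>))
      = - (antisymmetrizer n * tensor n (M(i := M (Suc n) + M i)))" if i: "i \<in> ?A" for i
  proof -
    have "?f (\<tau> * \<langle>Suc n \<leftrightarrow> i\<rangle>)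
        = - (of_int (sign (apply \<tau>)) * perm_elt \<tau> * tensor n (M(i := M (Suc n) + M i)))"
      if "\<tau> \<in> Sym n" for \<tau>
      using partial_trace_swap[of \<tau> "Suc n" i M] that i sign_mult_swap[of "Suc n" i \<tau>]
      by (simp add: perm_elt_mult mult.assoc)
    then show ?thesis
      by (simp add: antisymmetrizer_def sum_distrib_right sum_negf)
  qed
  have "partial_trace (Suc n) (antisymmetrizer (Suc n) * tensor (Suc n) M) = (\<Sum>\<sigma>\<in>Sym (Suc n). ?f \<sigma>)"
    by (simp only: antisymmetrizer_def sum_distrib_right partial_trace_sum of_int_eq_scal mult.assoc partial_trace_scal)
  also have "\<dots> = (\<Sum>\<tau>\<in>Sym n. ?f \<tau>) + (\<Sum>i\<in>?A. \<Sum>\<tau>\<in>Sym n. ?f (\<tau> * \<langle>Suc n \<leftrightarrow> i\<rangle>))"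
    unfolding S by (rule sum_perms_on_insert) auto
  also have "\<dots> = antisymmetrizer n * (scal (tr (M (Suc n))) * tensor n M)
      + (\<Sum>i\<in>?A. - (antisymmetrizer n * tensor n (M(i := M (Suc n) + M i))))"
    unfolding fixed using swap by simp
  also have "\<dots> = antisymmetrizer n * (scal (tr (M (Suc n))) * tensor n M
        - (\<Sum>i\<in>?A. tensor n (M(i := M (Suc n) + M i))))"
    by (simp add: sum_negf right_diff_distrib sum_distrib_left)
  finally show ?thesis .
qed

section \<open>Exponent tuples and the partial trace of symmetrized powers\<close>

definition exponents :: "nat \<Rightarrow> nat \<Rightarrow> (nat \<Rightarrow> nat) set" where
  "exponents n i = {h \<in> {1..n} \<rightarrow>\<^sub>E UNIV. (\<Sum>j=1..n. h j) = i}"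

lemma finite_exponents: "finite (exponents n i)"
  unfolding exponents_def by (rule finite_T_sym_index)

lemma sum_exponents_Suc:
  fixes f :: "(nat \<Rightarrow> nat) \<Rightarrow> 'b::comm_monoid_add"
  shows "(\<Sum>h\<in>exponents (Suc n) s. f h) = (\<Sum>m\<le>s. \<Sum>h\<in>exponents n (s - m). f (h(Suc n := m)))"
proof -
  have upd: "(\<Sum>j=1..n. (h(Suc n := m)) j) = (\<Sum>j=1..n. h j)" for h :: "nat \<Rightarrow> nat" and m
    by (intro sum.cong) auto
  \<comment> \<open>Dropping the last exponent resets it to \<open>undefined\<close>, the value that
    extensional functions on \<open>{1..n}\<close> take there.\<close>
  have "(\<Sum>h\<in>exponents (Suc n) s. f h) = (\<Sum>(m, h)\<in>(SIGMA m:{..s}. exponents n (s - m)). f (h(Suc n := m)))"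
  proof (rule sum.reindex_bij_witness[where j = "\<lambda>h. (h (Suc n), h(Suc n := undefined))" and
        i = "\<lambda>(m, h). h(Suc n := m)"], goal_cases)
    case (2 h)
    have "h(Suc n := undefined) \<in> {1..n} \<rightarrow>\<^sub>E UNIV"
      using 2 by (auto simp: exponents_def PiE_iff extensional_def)
    then show ?case using 2 upd[of h undefined] by (auto simp: exponents_def)
  next
    case (3 z)
    then obtain m h where z: "z = (m, h)" "h \<in> exponents n (s - m)" by auto
    then have "h (Suc n) = undefined" by (auto simp: exponents_def PiE_iff extensional_def)
    then show ?case using z(1) by (auto simp: fun_eq_iff)
  next
    case (4 z)
    then obtain m h where z: "z = (m, h)" "h \<in> exponents n (s - m)" "m \<le> s" by auto
    then have "h(Suc n := m) \<in> {1..Suc n} \<rightarrow>\<^sub>E UNIV"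
      by (auto simp: exponents_def PiE_iff extensional_def)
    then show ?case using z upd[of h m] by (simp add: exponents_def)
  qed auto
  then show ?thesis by (simp add: sum.Sigma finite_exponents)
qed

text \<open>A tuple \<open>h\<close> on the right arises once for each \<open>m\<close> with
  \<open>m + a \<le> h i\<close>; the truncated difference counts these, also when
  \<open>h i < a\<close>.\<close>

lemma sum_exponents_merge:
  fixes f :: "(nat \<Rightarrow> nat) \<Rightarrow> 'b::ring_1"
  assumes i: "i \<in> {1..n}"
  shows "(\<Sum>m\<le>s. \<Sum>h\<in>exponents n (s - m). f (h(i := h i + m + a)))
    = (\<Sum>h\<in>exponents n (s + a). of_nat (Suc (h i) - a) * f h)"
proof -
  have upd: "(\<Sum>j=1..n. (h(i := v)) j) + h i = (\<Sum>j=1..n. h j) + v" for h :: "nat \<Rightarrow> nat" and v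
  proof -
    have "(\<Sum>j\<in>{1..n} - {i}. (h(i := v)) j) = (\<Sum>j\<in>{1..n} - {i}. h j)"
      by (intro sum.cong) auto
    then show ?thesis
      using sum.remove[OF _ i, of h] sum.remove[OF _ i, of "h(i := v)"] by simp
  qed
  \<comment> \<open>This bound yields \<open>m \<le> s\<close> when a merged exponent is split
    again.\<close>
  have le: "h i \<le> t" if "h \<in> exponents n t" for h t
    using that member_le_sum[OF i, of h] by (auto simp: exponents_def)
  have ext: "h(i := v) \<in> {1..n} \<rightarrow>\<^sub>E UNIV" if "h \<in> exponents n t" for h t v
    using that i by (auto simp: exponents_def PiE_iff extensional_def)
  have "(\<Sum>(m, h)\<in>(SIGMA m:{..s}. exponents n (s - m)). f (h(i := h i + m + a)))
      = (\<Sum>(h, m)\<in>(SIGMA h:exponents n (s + a). {..<Suc (h i) - a}). f h)"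
  proof (rule sum.reindex_bij_witness[where j = "\<lambda>(m, h). (h(i := h i + m + a), m)" and
        i = "\<lambda>(h, m). (m, h(i := h i - (m + a)))"], goal_cases)
    case (1 z)
    then show ?case by (auto simp: fun_eq_iff)
  next
    case (2 z)
    then obtain m h where z: "z = (m, h)" "h \<in> exponents n (s - m)" "m \<le> s" by auto
    have "(\<Sum>j=1..n. (h(i := h i + m + a)) j) = s + a"
      using z upd[of h "h i + m + a"] by (simp add: exponents_def)
    then show ?case using z(1) ext[OF z(2)] by (simp add: exponents_def)
  next
    case (3 z)
    then show ?case by (auto simp: fun_eq_iff)
  next
    case (4 z)
    then obtain m h where z: "z = (h, m)" "h \<in> exponents n (s + a)" "m < Suc (h i) - a" by auto
    have ma: "m + a \<le> h i" using z(3) by simp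
    have "(\<Sum>j=1..n. (h(i := h i - (m + a))) j) = s - m"
      using z(2) upd[of h "h i - (m + a)"] ma le[OF z(2)] by (simp add: exponents_def)
    then show ?case using z(1) ext[OF z(2)] le[OF z(2)] ma by (simp add: exponents_def)
  next
    case (5 z)
    then show ?case by auto
  qed
  then show ?thesis by (simp add: sum.Sigma[symmetric] finite_exponents)
qed

lemma var_pow_add: "var_pow x (a + b) = var_pow x a + var_pow x b"
  by (simp add: var_pow_def plus_mon_def replicate_add)

text \<open>The extra exponent in the last factor treats both claims at once: \<open>a = 0\<close>
  is the plain trace, \<open>a = 1\<close> the trace after multiplication by \<open>x\<close> in the
  last position.\<close>

definition T_shift :: "nat \<Rightarrow> nat \<Rightarrow> nat \<Rightarrow> 'x \<Rightarrow> 'x tw_alg" where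
  "T_shift a s n x =
     (\<Sum>h\<in>exponents n s. tensor n (\<lambda>j. var_pow x (if j = n then h j + a else h j)))"

lemma T_sym_exponents: "T_sym i n x = (\<Sum>h\<in>exponents n i. tensor n (\<lambda>j. var_pow x (h j)))"
  by (simp add: T_sym_def exponents_def)

lemma T_shift_0: "T_shift 0 s n x = T_sym s n x"
  unfolding T_shift_def T_sym_exponents by (intro sum.cong refl tensor_cong) auto

lemma T_sym_mult_last:
  "T_sym s n x * tensor n (\<lambda>j. if j = n then var_pow x a else 0) = T_shift a s n x"
  unfolding T_shift_def T_sym_exponents sum_distrib_right tensor_mult
  by (intro sum.cong refl tensor_cong) (auto simp: var_pow_add)

lemma partial_trace_antisymmetrizer_T_shift:
  assumes "a \<le> 1"
  shows "partial_trace (Suc n) (antisymmetrizer (Suc n) * T_shift a s (Suc n) x)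
    = antisymmetrizer n * ((\<Sum>m\<le>s. scal (tr (var_pow x (m + a))) * T_sym (s - m) n x)
        - of_nat (s + a + (1 - a) * n) * T_sym (s + a) n x)"
proof -
  let ?t = "\<lambda>h. tensor n (\<lambda>j. var_pow x (h j))"
  have trace: "partial_trace (Suc n) (antisymmetrizer (Suc n) *
        tensor (Suc n) (\<lambda>j. var_pow x (if j = Suc n then (h(Suc n := m)) j + a else (h(Suc n := m)) j)))
      = antisymmetrizer n * (scal (tr (var_pow x (m + a))) * ?t h - (\<Sum>i=1..n. ?t (h(i := h i + m + a))))" for h m
  proof -
    have "tensor n (\<lambda>j. var_pow x (if j = Suc n then (h(Suc n := m)) j + a else (h(Suc n := m)) j)) = ?t h"
      by (rule tensor_cong) auto
    moreover have "tensor n ((\<lambda>j. var_pow x (if j = Suc n then (h(Suc n := m)) j + a else (h(Suc n := m)) j))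
        (i := var_pow x (m + a) + var_pow x (h i))) = ?t (h(i := h i + m + a))" if "i \<in> {1..n}" for i
      by (rule tensor_cong) (use that in \<open>auto simp: var_pow_add[symmetric] ac_simps\<close>)
    ultimately show ?thesis
      unfolding partial_trace_antisymmetrizer by (auto intro!: arg_cong2[of _ _ _ _ "(*)"] arg_cong2[of _ _ _ _ "(-)"] sum.cong)
  qed
  \<comment> \<open>Here \<open>a \<le> 1\<close> matters: it makes the difference untruncated, so
    the total is \<open>s + n\<close> for \<open>a = 0\<close> and \<open>s + 1\<close> for
    \<open>a = 1\<close>.\<close>
  have count: "(\<Sum>i=1..n. Suc (h i) - a) = s + a + (1 - a) * n" if "h \<in> exponents n (s + a)" for h
  proof -
    have "(\<Sum>i=1..n. Suc (h i) - a) = (\<Sum>i=1..n. h i + (1 - a))"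
      using assms by (intro sum.cong) auto
    then show ?thesis using that by (simp add: sum.distrib exponents_def)
  qed
  \<comment> \<open>The position \<open>i\<close> is moved outermost so that merging can be counted
    for each position separately.\<close>
  have "(\<Sum>m\<le>s. \<Sum>h\<in>exponents n (s - m). \<Sum>i=1..n. ?t (h(i := h i + m + a)))
      = (\<Sum>m\<le>s. \<Sum>i=1..n. \<Sum>h\<in>exponents n (s - m). ?t (h(i := h i + m + a)))"
    by (intro sum.cong refl sum.swap)
  also have "\<dots> = (\<Sum>i=1..n. \<Sum>m\<le>s. \<Sum>h\<in>exponents n (s - m). ?t (h(i := h i + m + a)))"
    by (rule sum.swap)
  also have "\<dots> = (\<Sum>i=1..n. \<Sum>h\<in>exponents n (s + a). of_nat (Suc (h i) - a) * ?t h)"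
    by (intro sum.cong refl sum_exponents_merge)
  also have "\<dots> = (\<Sum>h\<in>exponents n (s + a). of_nat (\<Sum>i=1..n. Suc (h i) - a) * ?t h)"
    by (subst sum.swap) (simp only: of_nat_sum sum_distrib_right)
  also have "\<dots> = of_nat (s + a + (1 - a) * n) * T_sym (s + a) n x"
    unfolding T_sym_exponents sum_distrib_left
    by (intro sum.cong refl) (simp only: count)
  finally have merged: "(\<Sum>m\<le>s. \<Sum>h\<in>exponents n (s - m). \<Sum>i=1..n. ?t (h(i := h i + m + a)))
      = of_nat (s + a + (1 - a) * n) * T_sym (s + a) n x" .
  show ?thesis
    unfolding T_shift_def sum_exponents_Suc sum_distrib_left[of "antisymmetrizer (Suc n)"] partial_trace_sum trace
    unfolding sum_distrib_left[symmetric] sum_subtractf merged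
    by (simp only: T_sym_exponents sum_distrib_left)
qed


section \<open>Traces of linear combinations and a uniform form of \<open>C_elt\<close>\<close>

lemma sum_nested_triangle:
  fixes g :: "nat \<Rightarrow> nat \<Rightarrow> 'b::comm_monoid_add"
  shows "(\<Sum>j\<le>k. \<Sum>m\<le>k - j. g j m) = (\<Sum>s\<le>k. \<Sum>j\<le>s. g j (s - j))"
proof -
  have "(SIGMA j:{..k}. {..k - j}) = {(i, j). i + j \<le> k}" by auto
  then show ?thesis
    unfolding sum.triangle_reindex_eq[symmetric] by (simp add: sum.Sigma)
qed

lemma antisymmetrizer_0: "antisymmetrizer 0 = (1 :: 'x tw_alg)"
proof -
  have "Tw 1 0 = (0 :: 'x tw)" by (simp add: zero_tw_def)
  then show ?thesis
    by (simp add: antisymmetrizer_def Sym_eq_perms_on perms_on_empty perm_elt_def)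
qed

lemma T_sym_0_right: "T_sym i 0 (x :: 'x) = (if i = 0 then 1 else 0)"
proof -
  have "tuple 0 M = 0" for M :: "nat \<Rightarrow> 'x mon"
    by (rule poly_mapping_eqI) simp
  then have "tensor 0 M = 1" for M :: "nat \<Rightarrow> 'x mon"
    by (simp add: tensor_def flip: zero_tw_def)
  then show ?thesis by (simp add: T_sym_def)
qed

lemma sigma_tr_0: "sigma_tr 0 x = 1"
  by (simp add: sigma_tr_eq_elem_sym elem_sym_def cyc_sum_empty rat_const_1)

text \<open>Since \<open>sigma_tr 0 x = 1\<close>, the leading term is the summand
  \<open>j = 0\<close>. The form also covers \<open>k = d + 1\<close>, where \<open>n = 0\<close>,
  so the second trace formula needs no separate case \<open>k = d\<close>.\<close>

lemma C_elt_eq: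
  assumes "k \<le> d + 1"
  shows "C_elt k d (x :: 'x) = antisymmetrizer (d + 1 - k) *
    (\<Sum>j\<le>k. scal ((-1) ^ j * sigma_tr j x) * T_sym (k - j) (d + 1 - k) x)"
proof (cases "k \<le> d")
  case True
  have m1: "(-1) ^ j = (scal ((-1) ^ j) :: 'x tw_alg)" for j
    using of_int_eq_scal[of "(-1) ^ j"] by simp
  have "{..k} = insert 0 {1..k}" by auto
  then show ?thesis
    using True by (simp add: C_elt_def Let_def antisymmetrizer_def m1 scal_mult mult.assoc sigma_tr_0 scal_1)
next
  case False
  then have k: "k = d + 1" using assms by simp
  \<comment> \<open>The empty tuple has sum 0, so only the summand with \<open>d + 1 - j = 0\<close>
    survives.\<close>
  have "(\<Sum>j\<le>d + 1. scal ((-1) ^ j * sigma_tr j x) * T_sym (d + 1 - j) 0 x)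
      = (\<Sum>j\<le>d + 1. if j = d + 1 then scal ((-1) ^ j * sigma_tr j x) else 0)"
    unfolding T_sym_0_right by (intro sum.cong) auto
  also have "\<dots> = scal ((-1) ^ (d + 1) * sigma_tr (d + 1) x)"
    by (subst sum.delta) auto
  finally show ?thesis
    unfolding k by (simp add: C_elt_def antisymmetrizer_0)
qed

text \<open>Grouping the trace terms by \<open>s = j + m\<close> turns the coefficient of
  \<open>T_sym (k - s) n x\<close> into a convolution of \<open>c\<close> with power traces, which
  is what Newton's identities evaluate.\<close>

lemma partial_trace_antisymmetrizer_combination:
  assumes "a \<le> 1"
  shows "partial_trace (Suc n) (antisymmetrizer (Suc n) * (\<Sum>j\<le>k. scal (c j) * T_shift a (k - j) (Suc n) x))
    = antisymmetrizer n * ((\<Sum>s\<le>k. scal (\<Sum>j\<le>s. c j * tr (var_pow x (s - j + a))) * T_sym (k - s) n x)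
        - (\<Sum>j\<le>k. scal (of_nat (k - j + a + (1 - a) * n) * c j) * T_sym (k - j + a) n x))"
proof -
  let ?T = "\<lambda>i. T_sym i n x"
  have "partial_trace (Suc n) (antisymmetrizer (Suc n) * (\<Sum>j\<le>k. scal (c j) * T_shift a (k - j) (Suc n) x))
      = (\<Sum>j\<le>k. scal (c j) * partial_trace (Suc n) (antisymmetrizer (Suc n) * T_shift a (k - j) (Suc n) x))"
    by (simp only: sum_distrib_left scal_left_commute[of "antisymmetrizer (Suc n)"] partial_trace_sum partial_trace_scal)
  also have "\<dots> = antisymmetrizer n * (\<Sum>j\<le>k. scal (c j) *
      ((\<Sum>m\<le>k - j. scal (tr (var_pow x (m + a))) * ?T (k - j - m))
        - of_nat (k - j + a + (1 - a) * n) * ?T (k - j + a)))"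
    unfolding partial_trace_antisymmetrizer_T_shift[OF assms] sum_distrib_left[of "antisymmetrizer n"] scal_left_commute[of "antisymmetrizer n"] ..
  also have "(\<Sum>j\<le>k. scal (c j) *
      ((\<Sum>m\<le>k - j. scal (tr (var_pow x (m + a))) * ?T (k - j - m))
        - of_nat (k - j + a + (1 - a) * n) * ?T (k - j + a)))
      = (\<Sum>j\<le>k. \<Sum>m\<le>k - j. scal (c j * tr (var_pow x (m + a))) * ?T (k - (j + m)))
        - (\<Sum>j\<le>k. scal (of_nat (k - j + a + (1 - a) * n) * c j) * ?T (k - j + a))"
    by (simp only: right_diff_distrib sum_subtractf sum_distrib_left of_nat_eq_scal
        mult.assoc[symmetric] scal_mult[symmetric] mult.commute[of "c _" "of_nat _"] diff_diff_left)
  also have "(\<Sum>j\<le>k. \<Sum>m\<le>k - j. scal (c j * tr (var_pow x (m + a))) * ?T (k - (j + m)))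
      = (\<Sum>s\<le>k. \<Sum>j\<le>s. scal (c j * tr (var_pow x (s - j + a))) * ?T (k - (j + (s - j))))"
    by (rule sum_nested_triangle)
  also have "\<dots> = (\<Sum>s\<le>k. scal (\<Sum>j\<le>s. c j * tr (var_pow x (s - j + a))) * ?T (k - s))"
    by (simp add: scal_sum sum_distrib_right)
  finally show ?thesis .
qed

section \<open>The two trace formulas\<close>

lemma newton_sigma_tr:
  "(\<Sum>j\<le>s. (-1) ^ j * sigma_tr j x * tr (var_pow x (Suc s - j)))
    = (-1) ^ s * (of_nat (Suc s) * sigma_tr (Suc s) x)"
  using newton_identity[where p = "\<lambda>m. tr (var_pow x m)"]
  by (simp only: sigma_tr_eq_elem_sym mult.assoc)

text \<open>At index \<open>s\<close> the trace terms contribute \<open>tr 0 - of_nat s\<close> and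
  merging removes \<open>d - s\<close>, leaving the same factor \<open>tr 0 - of_nat d\<close> for
  every \<open>s\<close>.\<close>

lemma partial_trace_C_elt:
  assumes "k \<le> d"
  shows "partial_trace (d + 1 - k) (C_elt k d (x :: 'x))
    = scal (tr 0 - of_nat d) * (antisymmetrizer (d - k) *
        (\<Sum>s\<le>k. scal ((-1) ^ s * sigma_tr s x) * T_sym (k - s) (d - k) x))"
proof -
  let ?n = "d - k" and ?c = "\<lambda>j. (-1) ^ j * sigma_tr j x"
  have n: "d + 1 - k = Suc ?n" using assms by simp
  have coeff: "(\<Sum>j\<le>s. ?c j * tr (var_pow x (s - j))) - of_nat (k - s + ?n) * ?c s
      = (tr 0 - of_nat d) * ?c s" if "s \<le> k" for s
  proof -
    \<comment> \<open>The summand \<open>j = s\<close> involves the trace of the empty word,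
      \<open>tr 0\<close>; the rest is Newton's identity for \<open>s = Suc t\<close>.\<close>
    have *: "(\<Sum>j\<le>s. ?c j * tr (var_pow x (s - j))) = ?c s * tr 0 - of_nat s * ?c s"
    proof (cases s)
      case 0
      then show ?thesis by (simp add: var_pow_def zero_mon_def)
    next
      case (Suc t)
      then show ?thesis
        using newton_sigma_tr[of x t] by (simp add: var_pow_def zero_mon_def algebra_simps)
    qed
    have "(of_nat d :: 'x tr_poly) = of_nat s + of_nat (k - s + ?n)"
      using that assms by (simp flip: of_nat_add)
    then show ?thesis unfolding * by (simp only: left_diff_distrib distrib_right diff_diff_eq mult.commute[of "tr 0"])
  qed
  have "partial_trace (d + 1 - k) (C_elt k d x)
      = antisymmetrizer ?n * ((\<Sum>s\<le>k. scal (\<Sum>j\<le>s. ?c j * tr (var_pow x (s - j))) * T_sym (k - s) ?n x)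
        - (\<Sum>s\<le>k. scal (of_nat (k - s + ?n) * ?c s) * T_sym (k - s) ?n x))"
    using partial_trace_antisymmetrizer_combination[of 0 ?n ?c k x] assms
    by (simp only: C_elt_eq n T_shift_0 add_0_right) (simp add: C_elt_eq n)
  also have "\<dots> = antisymmetrizer ?n * (\<Sum>s\<le>k. scal ((tr 0 - of_nat d) * ?c s) * T_sym (k - s) ?n x)"
    unfolding sum_subtractf[symmetric] left_diff_distrib[symmetric] scal_diff[symmetric]
    using coeff by simp
  also have "\<dots> = scal (tr 0 - of_nat d) * (antisymmetrizer ?n * (\<Sum>s\<le>k. scal (?c s) * T_sym (k - s) ?n x))"
    by (simp only: scal_mult[of "tr 0 - _"] mult.assoc sum_distrib_left[symmetric] scal_left_commute[of "antisymmetrizer _"])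
  finally show ?thesis .
qed

text \<open>At index \<open>j\<close> Newton's identity contributes \<open>-j\<close> and merging
  \<open>-(k + 1 - j)\<close>, in total \<open>-(k + 1)\<close>. All power traces have positive
  exponent, so \<open>tr 0\<close> never enters.\<close>

lemma partial_trace_C_elt_last:
  assumes "k \<le> d" and n: "n = d + 1 - k"
  shows "partial_trace n (C_elt k d (x :: 'x) * tensor n (\<lambda>j. if j = n then var_pow x 1 else 0))
    = - of_nat (k + 1) * C_elt (k + 1) d x"
proof -
  let ?n = "d - k" and ?c = "\<lambda>j. (-1) ^ j * sigma_tr j x" and ?T = "\<lambda>i. T_sym i (d - k) x"
  have n': "n = Suc ?n" using assms by simp
  have "C_elt k d x * tensor n (\<lambda>j. if j = n then var_pow x 1 else 0)
      = antisymmetrizer n * (\<Sum>j\<le>k. scal (?c j) * T_shift 1 (k - j) n x)"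
    using assms by (simp add: C_elt_eq mult.assoc sum_distrib_right T_sym_mult_last)
  then have "partial_trace n (C_elt k d x * tensor n (\<lambda>j. if j = n then var_pow x 1 else 0))
      = antisymmetrizer ?n * ((\<Sum>s\<le>k. scal (\<Sum>j\<le>s. ?c j * tr (var_pow x (s - j + 1))) * ?T (k - s))
        - (\<Sum>j\<le>k. scal (of_nat (k - j + 1) * ?c j) * ?T (k - j + 1)))"
    using partial_trace_antisymmetrizer_combination[of 1 ?n ?c k x] by (simp add: n')
  also have "(\<Sum>s\<le>k. scal (\<Sum>j\<le>s. ?c j * tr (var_pow x (s - j + 1))) * ?T (k - s))
      = (\<Sum>s\<le>k. scal (- (of_nat (Suc s) * ?c (Suc s))) * ?T (Suc k - Suc s))"
  proof (intro sum.cong refl arg_cong2[of _ _ _ _ "(*)"] arg_cong[of _ _ scal])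
    fix s
    have "(\<Sum>j\<le>s. ?c j * tr (var_pow x (s - j + 1))) = (\<Sum>j\<le>s. ?c j * tr (var_pow x (Suc s - j)))"
      by (intro sum.cong refl) (simp add: Suc_diff_le)
    then show "(\<Sum>j\<le>s. ?c j * tr (var_pow x (s - j + 1))) = - (of_nat (Suc s) * ?c (Suc s))"
      unfolding newton_sigma_tr by (simp add: algebra_simps)
  qed simp
  \<comment> \<open>The added summand \<open>j = 0\<close> has coefficient 0.\<close>
  also have "\<dots> = (\<Sum>j\<le>Suc k. scal (- (of_nat j * ?c j)) * ?T (Suc k - j))"
    unfolding sum.atMost_Suc_shift[of _ k] by (simp add: scal_0)
  \<comment> \<open>The added summand \<open>j = Suc k\<close> has coefficient 0, so both sums now
    share one index range.\<close>
  also have "(\<Sum>j\<le>k. scal (of_nat (k - j + 1) * ?c j) * ?T (k - j + 1))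
      = (\<Sum>j\<le>Suc k. scal (of_nat (Suc k - j) * ?c j) * ?T (Suc k - j))"
    by (simp add: scal_0 Suc_diff_le algebra_simps)
  also have "(\<Sum>j\<le>Suc k. scal (- (of_nat j * ?c j)) * ?T (Suc k - j))
        - (\<Sum>j\<le>Suc k. scal (of_nat (Suc k - j) * ?c j) * ?T (Suc k - j))
      = (\<Sum>j\<le>Suc k. scal (- of_nat (Suc k)) * (scal (?c j) * ?T (Suc k - j)))"
    unfolding sum_subtractf[symmetric] left_diff_distrib[symmetric] scal_diff[symmetric]
  proof (rule sum.cong[OF refl])
    fix j assume "j \<in> {..Suc k}"
    then have "(of_nat (Suc k) :: 'x tr_poly) = of_nat j + of_nat (Suc k - j)"
      by (simp flip: of_nat_add)
    then have "- (of_nat j * ?c j) - of_nat (Suc k - j) * ?c j = - of_nat (Suc k) * ?c j"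
      by (simp only:) (simp add: algebra_simps)
    then show "scal (- (of_nat j * ?c j) - of_nat (Suc k - j) * ?c j) * ?T (Suc k - j)
        = scal (- of_nat (Suc k)) * (scal (?c j) * ?T (Suc k - j))"
      by (simp only: scal_mult mult.assoc)
  qed
  also have "antisymmetrizer ?n * \<dots> = scal (- of_nat (Suc k)) * (antisymmetrizer ?n * (\<Sum>j\<le>Suc k. scal (?c j) * ?T (Suc k - j)))"
    by (simp only: sum_distrib_left[symmetric] scal_left_commute[of "antisymmetrizer _"])
  also have "scal (- of_nat (Suc k)) = (- of_nat (k + 1) :: 'x tw_alg)"
    using scal_diff[of 0 "of_nat (Suc k)"] by (simp add: scal_0 of_nat_eq_scal del: of_nat_Suc)
  also have "antisymmetrizer ?n * (\<Sum>j\<le>Suc k. scal (?c j) * ?T (Suc k - j)) = C_elt (k + 1) d x"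
    using assms by (simp add: C_elt_eq)
  finally show ?thesis .
qed

theorem theorem3p14:
  fixes d k n :: nat and x :: 'x
  assumes "d \<ge> 1" and "k \<le> d" and "n = d + 1 - k"
  shows "spec_eq d (n - 1) (partial_trace n (C_elt k d x)) 0 \<and>
         spec_eq d (n - 1)
           (partial_trace n (C_elt k d x * tensor n (\<lambda>j. if j = n then var_pow x 1 else 0)))
           (- of_nat (k + 1) * C_elt (k + 1) d x)"
proof
  \<comment> \<open>The cofactor of \<open>scal (tr 0 - of_nat d)\<close> in the first trace, which
    witnesses membership in the ideal.\<close>
  let ?z = "antisymmetrizer (d - k) * (\<Sum>s\<le>k. scal ((-1) ^ s * sigma_tr s x) * T_sym (k - s) (d - k) x)"
  have n: "n - 1 = d - k" using assms by simp
  have "?z \<in> TX (d - k)"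
    by (auto simp: antisymmetrizer_def T_sym_def
        intro!: mult_in_TX sum_in_TX scal_in_TX of_int_in_TX perm_elt_in_TX tensor_in_TX)
  then show "spec_eq d (n - 1) (partial_trace n (C_elt k d x)) 0"
    unfolding assms(3) partial_trace_C_elt[OF assms(2)] spec_eq_def tr_one_ideal_eq
    using n assms by (auto simp: zero_in_TX intro: mult_in_TX scal_in_TX)
  have "C_elt (k + 1) d x \<in> TX (n - 1)"
    using C_elt_in_TX[of "k + 1" d x] assms by simp
  moreover have "(- of_nat (k + 1) :: 'x tw_alg) \<in> TX (n - 1)"
    using of_int_in_TX[of "- int (k + 1)" "n - 1"] by simp
  \<comment> \<open>The two sides are equal, so their difference is 0.\<close>
  moreover have "0 \<in> (tr_one_ideal d (n - 1) :: 'x tw_alg set)"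
    unfolding tr_one_ideal_eq using zero_in_TX[of "n - 1"] by force
  ultimately show "spec_eq d (n - 1)
      (partial_trace n (C_elt k d x * tensor n (\<lambda>j. if j = n then var_pow x 1 else 0)))
      (- of_nat (k + 1) * C_elt (k + 1) d x)"
    unfolding partial_trace_C_elt_last[OF assms(2,3)] spec_eq_def
    by (simp add: mult_in_TX)
qed

end
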